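(* Each of the four numbers $\frac{1+\sqrt5}{2}$, $1+\sqrt2$, $\frac{1+\sqrt{13}}{2}$, $\frac{1+\sqrt{17}}{2}$ has property (CFF); that is, for each such $\beta$, every element of $\mathbb{Q}(\beta)$ has a finite $\beta$-continued fraction expansion.
   Context: $\beta$-integers: for real $\beta>1$, every real $x\ge 0$ has a unique (up to leading zeros) greedy $\beta$-expansion $x=\sum_{i=-\infty}^{k}x_i\beta^i$ with integer digits $0\le x_i<\beta$ such that $\sum_{i=-\infty}^{j}x_i\beta^i<\beta^{j+1}$ for every $j\le k$. The set $\mathbb{Z}_\beta$ of $\beta$-integers consists of all real $x$ such that the greedy $\beta$-expansion of $|x|$ has $x_i=0$ for all $i<0$. $\beta$-continued fraction of $\xi\in\mathbb{R}$: put $\xi_0=\xi$ and, for $n\ge 0$, $a_n=\max\{y\in\mathbb{Z}_\beta: y\le \xi_n\}$; if $\xi_n\in\mathbb{Z}_\beta$ the algorithm stops and the expansion $[a_0,\dots,a_n]$ is finite; otherwise $\xi_{n+1}=1/(\xi_n-a_n)$. If it never stops, the expansion is the infinite sequence $[a_0,a_1,\dotsc]$. Property (CFF) of $\beta$: every element of $\mathbb{Q}(\beta)$ has a finite $\beta$-continued fraction expansion. *)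

theory Defs
  imports "HOL-Analysis.Infinite_Sum" "HOL-Algebra.Generated_Fields"
    "HOL-Algebra.Algebraic_Closure_Type"
begin

text \<open>
  A digit string is a function \<open>d :: int \<Rightarrow> int\<close>; the digits above the leading position \<open>k\<close> are
  required to vanish, so that padding with leading zeros does not change \<open>d\<close>.
\<close>

definition greedy_expansion :: "real \<Rightarrow> (int \<Rightarrow> int) \<Rightarrow> int \<Rightarrow> real \<Rightarrow> bool" where
  "greedy_expansion \<beta> d k x \<longleftrightarrow>
     (\<forall>i. 0 \<le> d i \<and> real_of_int (d i) < \<beta>) \<and>
     (\<forall>i>k. d i = 0) \<and>
     ((\<lambda>i. real_of_int (d i) * \<beta> powi i) has_sum x) {..k} \<and>
     (\<forall>j\<le>k. (\<Sum>\<^sub>\<infinity>i\<in>{..j}. real_of_int (d i) * \<beta> powi i) < \<beta> powi (j + 1))"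

text \<open>
  For \<open>\<beta> > 1\<close> and \<open>x \<ge> 0\<close> the digit function \<open>d\<close> of a greedy expansion exists and is unique, so the
  existential quantifier below refers to \<^emph>\<open>the\<close> greedy expansion of the absolute value.
\<close>

definition beta_integers :: "real \<Rightarrow> real set" where
  "beta_integers \<beta> = {x. \<exists>d k. greedy_expansion \<beta> d k \<bar>x\<bar> \<and> (\<forall>i<0. d i = 0)}"

definition beta_floor :: "real \<Rightarrow> real \<Rightarrow> real" where
  "beta_floor \<beta> x = (GREATEST y. y \<in> beta_integers \<beta> \<and> y \<le> x)"

text \<open>
  The \<open>n\<close>-th complete quotient is \<open>None\<close> if the algorithm has stopped before step \<open>n\<close>.
\<close>

primrec beta_complete_quotient :: "real \<Rightarrow> real \<Rightarrow> nat \<Rightarrow> real option" where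
  "beta_complete_quotient \<beta> \<xi> 0 = Some \<xi>"
| "beta_complete_quotient \<beta> \<xi> (Suc n) =
     (case beta_complete_quotient \<beta> \<xi> n of
        None \<Rightarrow> None
      | Some x \<Rightarrow> if x \<in> beta_integers \<beta> then None else Some (1 / (x - beta_floor \<beta> x)))"

definition beta_partial_quotient :: "real \<Rightarrow> real \<Rightarrow> nat \<Rightarrow> real option" where
  "beta_partial_quotient \<beta> \<xi> n = map_option (beta_floor \<beta>) (beta_complete_quotient \<beta> \<xi> n)"

definition finite_beta_cf :: "real \<Rightarrow> real \<Rightarrow> bool" where
  "finite_beta_cf \<beta> \<xi> \<longleftrightarrow> (\<exists>n. beta_partial_quotient \<beta> \<xi> n = None)"

text \<open>
  The subfield of the reals generated by \<open>\<beta>\<close>; it contains the rationals automatically.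
\<close>

definition rat_adjoin :: "real \<Rightarrow> real set" where
  "rat_adjoin \<beta> = generate_field (ring_of_type_algebra :: real ring) {\<beta>}"

definition CFF :: "real \<Rightarrow> bool" where
  "CFF \<beta> \<longleftrightarrow> (\<forall>\<xi> \<in> rat_adjoin \<beta>. finite_beta_cf \<beta> \<xi>)"

end

theory Submission
  imports Defs
begin

text \<open>
  All four bases are of the form \<open>\<beta> = (a + sqrt (a\<^sup>2 + 4 * b)) / 2\<close> with integers \<open>a, b \<ge> 1\<close>, so the
  conjugate \<open>\<beta>'\<close> is smaller than \<open>\<beta>\<close> in absolute value.  Hence a nonnegative \<open>\<beta>\<close>-integer \<open>x\<close> lies in
  \<open>\<int>[\<beta>]\<close>, its conjugate \<open>x'\<close> satisfies \<open>\<bar>x'\<bar> \<le> x\<close>, and unless \<open>x\<close> is a single digit even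
  \<open>\<bar>x'\<bar> \<le> \<kappa> * x\<close> with a constant \<open>\<kappa> < 1\<close> (lemma \<open>beta_integer_conjugate\<close>).

  Suppose an element of \<open>\<rat>(\<beta>)\<close> has an infinite expansion with partial quotients \<open>c n\<close>.  Writing a
  complete quotient as a fraction of elements of \<open>\<int>[\<beta>]\<close> turns the expansion into a Euclidean
  algorithm with nonzero remainders \<open>r n\<close> in \<open>\<int>[\<beta>]\<close>.  The remainders decrease like \<open>1 / Q n\<close>, where
  \<open>Q\<close> are the continuants of \<open>c\<close>, while their conjugates grow at most like \<open>Q n\<close>, since the conjugate
  quotients are dominated by the quotients.  Each partial quotient with more than one digit gains a
  constant factor in the second estimate.  If there were infinitely many of these, the norms of the
  remainders would tend to 0, but they are nonzero integers
  (lemma \<open>partial_quotients_eventually_digits\<close>).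

  So from some point on all partial quotients are positive integers below \<open>\<beta>\<close>, that is, 1 or 2, and
  all complete quotients are below \<open>\<beta>\<close> (lemma \<open>infinite_beta_cf_digit_tail\<close>).  For each base this
  bound forces the tail to be eventually constant.  The value of such a tail is \<open>(1 + sqrt 5) / 2\<close> or
  \<open>1 + sqrt 2\<close>, which lies outside \<open>\<rat>(\<beta>)\<close>, or, for the golden ratio, is \<open>\<beta>\<close> itself and violates
  the bound.
\<close>

section \<open>Digit expansions and the beta-floor\<close>

text \<open>
  Without fractional digits every sum over a half-line of positions is a finite sum, so all the
  conditions on a greedy expansion can be read off a digit string indexed by natural numbers.
\<close>

lemma has_sum_digits:
  fixes \<beta> :: real and d :: "int \<Rightarrow> int"
  assumes "\<And>i. i < 0 \<Longrightarrow> d i = 0"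
  shows "((\<lambda>i. real_of_int (d i) * \<beta> powi i) has_sum (\<Sum>i<nat (j + 1). real_of_int (d (int i)) * \<beta> ^ i)) {..j}"
proof (rule has_sum_finite_neutralI)
  show "finite (int ` {..<nat (j + 1)})" by simp
  show "int ` {..<nat (j + 1)} \<subseteq> {..j}" by auto
  show "real_of_int (d i) * \<beta> powi i = 0" if "i \<in> {..j} - int ` {..<nat (j + 1)}" for i
  proof -
    have "i < 0"
    proof (rule ccontr)
      assume "\<not> i < 0"
      then have "i = int (nat i)" "nat i < nat (j + 1)" using that by auto
      then show False using that by blast
    qed
    then show ?thesis by (simp add: assms)
  qed
  show "(\<Sum>i<nat (j + 1). real_of_int (d (int i)) * \<beta> ^ i)
      = (\<Sum>i\<in>int ` {..<nat (j + 1)}. real_of_int (d i) * \<beta> powi i)"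
    by (simp add: sum.reindex power_int_def)
qed

lemma beta_integer_digits:
  fixes x \<beta> :: real
  assumes "x \<in> beta_integers \<beta>"
  obtains e :: "nat \<Rightarrow> int" and N where
    "\<And>i. 0 \<le> e i" "\<And>i. e i < \<beta>" "\<And>i. N \<le> i \<Longrightarrow> e i = 0"
    "\<bar>x\<bar> = (\<Sum>i<N. e i * \<beta> ^ i)"
proof -
  from assms obtain d k where g: "greedy_expansion \<beta> d k \<bar>x\<bar>" and d0: "\<And>i. i < 0 \<Longrightarrow> d i = 0"
    unfolding beta_integers_def by blast
  have "\<bar>x\<bar> = (\<Sum>i<nat (k + 1). d (int i) * \<beta> ^ i)"
    using g has_sum_digits[of d \<beta> k, OF d0] has_sum_unique
    unfolding greedy_expansion_def by blast
  moreover have "d (int i) = 0" if "nat (k + 1) \<le> i" for i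
  proof -
    have "k < int i" using that by linarith
    then show ?thesis using g unfolding greedy_expansion_def by blast
  qed
  ultimately show ?thesis
    using that[of "\<lambda>i. d (int i)" "nat (k + 1)"] g unfolding greedy_expansion_def by blast
qed

lemma digits_beta_integer:
  fixes \<beta> :: real and e :: "nat \<Rightarrow> int"
  assumes \<beta>: "1 < \<beta>" and e: "\<And>i. 0 \<le> e i" "\<And>i. e i < \<beta>"
    and greedy: "\<And>j. j \<le> N \<Longrightarrow> (\<Sum>i<j. e i * \<beta> ^ i) < \<beta> ^ j"
  shows "(\<Sum>i<N. e i * \<beta> ^ i) \<in> beta_integers \<beta>"
proof -
  define d where "d i = (if 0 \<le> i \<and> i < int N then e (nat i) else 0)" for i
  have hs: "((\<lambda>i. real_of_int (d i) * \<beta> powi i) has_sum (\<Sum>i<nat (j + 1). e i * \<beta> ^ i)) {..j}"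
    if "j \<le> int N - 1" for j
  proof -
    have "(\<Sum>i<nat (j + 1). real_of_int (d (int i)) * \<beta> ^ i) = (\<Sum>i<nat (j + 1). e i * \<beta> ^ i)"
      by (rule sum.cong) (use that in \<open>auto simp: d_def\<close>)
    then show ?thesis using has_sum_digits[of d \<beta> j] by (simp add: d_def)
  qed
  have "0 \<le> (\<Sum>i<N. e i * \<beta> ^ i)" using \<beta> e by (intro sum_nonneg) auto
  moreover have "(\<Sum>\<^sub>\<infinity>i\<in>{..j}. real_of_int (d i) * \<beta> powi i) < \<beta> powi (j + 1)" if j: "j \<le> int N - 1" for j
  proof (cases "0 \<le> j + 1")
    case True
    have "nat (j + 1) \<le> N" using j by simp
    from greedy[OF this] show ?thesis
      using True infsumI[OF hs[OF j]] by (simp add: power_int_def)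
  next
    case False
    then show ?thesis using infsumI[OF hs[OF j]] \<beta> by simp
  qed
  moreover have "0 \<le> d i \<and> real_of_int (d i) < \<beta>" for i using e \<beta> by (auto simp: d_def)
  moreover have "d i = 0" if "i > int N - 1 \<or> i < 0" for i using that by (auto simp: d_def)
  ultimately have "greedy_expansion \<beta> d (int N - 1) \<bar>\<Sum>i<N. e i * \<beta> ^ i\<bar>"
    unfolding greedy_expansion_def using hs[of "int N - 1"] by auto
  then show ?thesis
    unfolding beta_integers_def using \<open>\<And>i. i > int N - 1 \<or> i < 0 \<Longrightarrow> d i = 0\<close> by blast
qed

lemma beta_integers_uminus: "- x \<in> beta_integers \<beta> \<longleftrightarrow> x \<in> beta_integers \<beta>"
  by (simp add: beta_integers_def)

text \<open>
  Peeling off the leading digit \<open>\<lfloor>x / \<beta> ^ N\<rfloor>\<close> leaves a remainder below \<open>\<beta> ^ N\<close>, and the greedy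
  condition at the top position is the bound \<open>x < \<beta> ^ (N + 1)\<close> itself.  Stopping after the digit of
  \<open>\<beta> ^ 0\<close> leaves an error below 1.
\<close>

lemma greedy_digits_exist:
  fixes x \<beta> :: real
  assumes \<beta>: "1 < \<beta>" and x: "0 \<le> x" "x < \<beta> ^ N"
  shows "\<exists>e :: nat \<Rightarrow> int. (\<forall>i. (0 :: int) \<le> e i \<and> e i < \<beta>) \<and>
     (\<forall>j\<le>N. (\<Sum>i<j. e i * \<beta> ^ i) < \<beta> ^ j) \<and>
     (\<Sum>i<N. e i * \<beta> ^ i) \<le> x \<and> x < (\<Sum>i<N. e i * \<beta> ^ i) + 1"
  using x
proof (induction N arbitrary: x)
  case 0
  then show ?case using \<beta> by (intro exI[of _ "\<lambda>_. 0"]) auto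
next
  case (Suc N)
  define q where "q = \<lfloor>x / \<beta> ^ N\<rfloor>"
  have pos: "0 < \<beta> ^ N" using \<beta> by simp
  have q: "real_of_int q \<le> x / \<beta> ^ N" "x / \<beta> ^ N < q + 1"
    by (simp_all add: q_def)
  then have "q * \<beta> ^ N \<le> x" "x - q * \<beta> ^ N < \<beta> ^ N"
    using pos by (simp_all add: field_simps)
  then obtain e :: "nat \<Rightarrow> int" where e: "\<And>i. 0 \<le> e i \<and> e i < \<beta>"
     "\<And>j. j \<le> N \<Longrightarrow> (\<Sum>i<j. e i * \<beta> ^ i) < \<beta> ^ j"
     "(\<Sum>i<N. e i * \<beta> ^ i) \<le> x - q * \<beta> ^ N" "x - q * \<beta> ^ N < (\<Sum>i<N. e i * \<beta> ^ i) + 1"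
    using Suc.IH[of "x - q * \<beta> ^ N"] by auto
  define f where "f = e(N := q)"
  have low: "(\<Sum>i<j. f i * \<beta> ^ i) = (\<Sum>i<j. e i * \<beta> ^ i)" if "j \<le> N" for j
    by (rule sum.cong) (use that in \<open>auto simp: f_def\<close>)
  then have top: "(\<Sum>i<Suc N. f i * \<beta> ^ i) = (\<Sum>i<N. e i * \<beta> ^ i) + q * \<beta> ^ N"
    by (simp add: f_def)
  have "0 \<le> q" using Suc.prems pos by (simp add: q_def)
  moreover have "q < \<beta>"
  proof -
    have "x / \<beta> ^ N < \<beta>" using Suc.prems pos by (simp add: field_simps)
    with q show ?thesis by linarith
  qed
  ultimately have "0 \<le> f i \<and> f i < \<beta>" for i using e(1)[of i] by (simp add: f_def)
  moreover have "(\<Sum>i<j. f i * \<beta> ^ i) < \<beta> ^ j" if "j \<le> Suc N" for j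
  proof (cases "j = Suc N")
    case True
    then show ?thesis using top e(3) Suc.prems by simp
  next
    case False
    then show ?thesis using that low[of j] e(2)[of j] by simp
  qed
  ultimately show ?case using top e(3,4) by (intro exI[of _ f]) auto
qed

lemma power_beta_integer:
  assumes "1 < \<beta>"
  shows "\<beta> ^ k \<in> beta_integers \<beta>"
proof -
  define e :: "nat \<Rightarrow> int" where "e i = (if i = k then 1 else 0)" for i
  have s: "(\<Sum>i<j. e i * \<beta> ^ i) = (if k < j then \<beta> ^ k else 0)" for j
    by (simp add: e_def if_distrib if_distribR sum.delta cong: if_cong)
  have "(\<Sum>i<Suc k. e i * \<beta> ^ i) \<in> beta_integers \<beta>"
    by (rule digits_beta_integer[OF assms]) (use assms in \<open>auto simp only: s, auto simp: e_def\<close>)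
  then show ?thesis using s[of "Suc k"] by simp
qed

text \<open>
  A nonzero digit at position \<open>i\<close> contributes at least \<open>\<beta> ^ i\<close>, so a bound on the number leaves
  finitely many positions, each with finitely many possible digits.
\<close>

lemma finite_bounded_beta_integers:
  assumes "1 < \<beta>"
  shows "finite {x \<in> beta_integers \<beta>. \<bar>x\<bar> \<le> M}"
proof -
  obtain n where n: "M < \<beta> ^ n" using assms real_arch_pow by blast
  define A where "A = (\<lambda>e :: nat \<Rightarrow> int. \<Sum>i<n. e i * \<beta> ^ i) ` PiE {..<n} (\<lambda>_. {0..\<lfloor>\<beta>\<rfloor>})"
  have "finite A" unfolding A_def by (intro finite_imageI finite_PiE) auto
  have "\<bar>x\<bar> \<in> A" if x: "x \<in> beta_integers \<beta>" "\<bar>x\<bar> \<le> M" for x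
  proof -
    obtain e :: "nat \<Rightarrow> int" and N where e: "\<And>i. 0 \<le> e i" "\<And>i. e i < \<beta>" "\<And>i. N \<le> i \<Longrightarrow> e i = 0"
      and eq: "\<bar>x\<bar> = (\<Sum>i<N. e i * \<beta> ^ i)" using beta_integer_digits[OF x(1)] by blast
    have big: "e i = 0" if "n \<le> i" for i
    proof (rule ccontr)
      assume "e i \<noteq> 0"
      then have "i < N" "1 \<le> e i" using e(1)[of i] e(3)[of i] by linarith+
      have "\<beta> ^ n \<le> \<beta> ^ i" using that assms by simp
      also have "\<dots> \<le> e i * \<beta> ^ i" using \<open>1 \<le> e i\<close> assms by simp
      also have "\<dots> \<le> (\<Sum>i<N. e i * \<beta> ^ i)"
        by (rule member_le_sum[where f = "\<lambda>i. e i * \<beta> ^ i"]) (use \<open>i < N\<close> e assms in auto)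
      finally show False using eq x(2) n by linarith
    qed
    have "(\<Sum>i<N. e i * \<beta> ^ i) = (\<Sum>i<max n N. e i * \<beta> ^ i)"
      by (rule sum.mono_neutral_left) (use e in auto)
    also have "\<dots> = (\<Sum>i<n. e i * \<beta> ^ i)"
      by (rule sum.mono_neutral_right) (use big in auto)
    also have "\<dots> = (\<Sum>i<n. restrict e {..<n} i * \<beta> ^ i)" by simp
    finally have *: "\<bar>x\<bar> = (\<Sum>i<n. restrict e {..<n} i * \<beta> ^ i)" using eq by simp
    have "e i \<le> \<lfloor>\<beta>\<rfloor>" for i using e(2)[of i] by linarith
    then have "restrict e {..<n} \<in> PiE {..<n} (\<lambda>_. {0..\<lfloor>\<beta>\<rfloor>})"
      using e(1) by auto
    with * show ?thesis unfolding A_def by blast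
  qed
  moreover have "x \<in> A \<union> uminus ` A" if "\<bar>x\<bar> \<in> A" for x
  proof (cases "0 \<le> x")
    case False
    then have "x = - \<bar>x\<bar>" by simp
    then show ?thesis using that by blast
  qed (use that in simp)
  ultimately have "{x \<in> beta_integers \<beta>. \<bar>x\<bar> \<le> M} \<subseteq> A \<union> uminus ` A"
    by blast
  then show ?thesis using \<open>finite A\<close> finite_subset by blast
qed

text \<open>
  The set of candidates for the floor is unbounded below.  It contains the negative of a large power
  of \<open>\<beta>\<close>, and by finiteness only finitely many candidates lie above that.
\<close>

lemma beta_floor:
  assumes \<beta>: "1 < \<beta>"
  shows beta_floor_in: "beta_floor \<beta> x \<in> beta_integers \<beta>"
    and beta_floor_le: "beta_floor \<beta> x \<le> x"
    and beta_floor_greatest: "y \<in> beta_integers \<beta> \<Longrightarrow> y \<le> x \<Longrightarrow> y \<le> beta_floor \<beta> x"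
proof -
  obtain k where k: "\<bar>x\<bar> < \<beta> ^ k" using \<beta> real_arch_pow by blast
  define F where "F = {y \<in> beta_integers \<beta>. \<bar>y\<bar> \<le> \<beta> ^ k} \<inter> {y. y \<le> x}"
  have fin: "finite F" unfolding F_def using finite_bounded_beta_integers[OF \<beta>] by blast
  have mem: "- (\<beta> ^ k) \<in> F"
    unfolding F_def using k power_beta_integer[OF \<beta>, of k] \<beta>
    by (auto simp: beta_integers_uminus)
  define m where "m = Max F"
  have m: "m \<in> F" unfolding m_def using fin mem by (intro Max_in) auto
  have max: "y \<le> m" if y: "y \<in> beta_integers \<beta>" "y \<le> x" for y
  proof (cases "- (\<beta> ^ k) \<le> y")
    case True
    then have "y \<in> F" using y k by (auto simp: F_def)
    then show ?thesis unfolding m_def using fin by simp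
  next
    case False
    then show ?thesis using m by (auto simp: F_def)
  qed
  have "beta_floor \<beta> x = m"
    unfolding beta_floor_def by (rule Greatest_equality) (use m max in \<open>auto simp: F_def\<close>)
  then show "beta_floor \<beta> x \<in> beta_integers \<beta>" "beta_floor \<beta> x \<le> x"
    "y \<in> beta_integers \<beta> \<Longrightarrow> y \<le> x \<Longrightarrow> y \<le> beta_floor \<beta> x"
    using m max by (auto simp: F_def)
qed

lemma beta_floor_gap:
  assumes \<beta>: "1 < \<beta>" and "0 \<le> x"
  shows "x < beta_floor \<beta> x + 1"
proof -
  obtain N where N: "x < \<beta> ^ N" using \<beta> real_arch_pow by blast
  from greedy_digits_exist[OF \<beta> \<open>0 \<le> x\<close> N] obtain e :: "nat \<Rightarrow> int"
    where e: "\<forall>i. 0 \<le> e i \<and> e i < \<beta>" "\<forall>j\<le>N. (\<Sum>i<j. e i * \<beta> ^ i) < \<beta> ^ j"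
     "(\<Sum>i<N. e i * \<beta> ^ i) \<le> x" "x < (\<Sum>i<N. e i * \<beta> ^ i) + 1"
    by (elim exE conjE) (rule that)
  have "(\<Sum>i<N. e i * \<beta> ^ i) \<in> beta_integers \<beta>"
    by (rule digits_beta_integer[OF \<beta>]) (use e in auto)
  from beta_floor_greatest[OF \<beta> this e(3)] e(4) show ?thesis by linarith
qed

section \<open>Three-term recurrences\<close>

text \<open>
  With positive coefficients \<open>c\<close> and initial values 1, 1 these are the continuants of \<open>c\<close>; with
  coefficients \<open>-c\<close> they are the remainders of the Euclidean algorithm with quotients \<open>c\<close>.  The
  conjugates of the remainders obey the same recurrence with the conjugate quotients.
\<close>

fun three_term :: "(nat \<Rightarrow> real) \<Rightarrow> real \<Rightarrow> real \<Rightarrow> nat \<Rightarrow> real" where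
  "three_term c u v 0 = u"
| "three_term c u v (Suc 0) = v"
| "three_term c u v (Suc (Suc n)) = c n * three_term c u v (Suc n) + three_term c u v n"

lemma continuant_mono:
  assumes "\<And>n. 1 \<le> c n"
  shows "1 \<le> three_term c 1 1 n \<and> three_term c 1 1 n \<le> three_term c 1 1 (Suc n)"
proof (induction n)
  case (Suc n)
  have "1 * three_term c 1 1 (Suc n) \<le> c n * three_term c 1 1 (Suc n)"
    by (rule mult_right_mono) (use Suc assms in auto)
  then have "three_term c 1 1 (Suc n) + 0 \<le> c n * three_term c 1 1 (Suc n) + three_term c 1 1 n"
    using Suc by (intro add_mono) auto
  with Suc show ?case by simp
qed simp

lemma three_term_dominated_from:
  assumes c: "\<And>n. 1 \<le> c n" and d: "\<And>n. \<bar>d n\<bar> \<le> c n"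
    and start: "\<bar>three_term d u v N\<bar> \<le> K * three_term c 1 1 N"
      "\<bar>three_term d u v (Suc N)\<bar> \<le> K * three_term c 1 1 (Suc N)"
    and "N \<le> n"
  shows "\<bar>three_term d u v n\<bar> \<le> K * three_term c 1 1 n"
proof -
  have "\<bar>three_term d u v (N + k)\<bar> \<le> K * three_term c 1 1 (N + k) \<and>
      \<bar>three_term d u v (Suc (N + k))\<bar> \<le> K * three_term c 1 1 (Suc (N + k))" for k
  proof (induction k)
    case (Suc k)
    have "\<bar>d (N + k) * three_term d u v (Suc (N + k))\<bar> \<le> c (N + k) * (K * three_term c 1 1 (Suc (N + k)))"
      unfolding abs_mult using Suc d c by (intro mult_mono) (auto intro: order_trans[OF abs_ge_zero])
    then have "\<bar>d (N + k) * three_term d u v (Suc (N + k)) + three_term d u v (N + k)\<bar>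
        \<le> c (N + k) * (K * three_term c 1 1 (Suc (N + k))) + K * three_term c 1 1 (N + k)"
      using Suc by linarith
    then show ?case using Suc by (simp add: algebra_simps)
  qed (use start in simp)
  from this[of "n - N"] \<open>N \<le> n\<close> show ?thesis by simp
qed

text \<open>
  A step with \<open>\<bar>d n\<bar> \<le> \<kappa> * c n\<close> lowers the ratio to the continuant at the next index to
  \<open>(1 + \<kappa>) / 2\<close>, because the term \<open>c n * Q (n + 1)\<close> is at least as large as \<open>Q n\<close>.  The step after it
  mixes this ratio with the old one, giving \<open>(1 + (1 + \<kappa>) / 2) / 2 = (3 + \<kappa>) / 4\<close>.  Two consecutive
  indices with that ratio pass it on to all later ones.
\<close>

lemma three_term_decay:
  assumes c: "\<And>n. 1 \<le> c n" and d: "\<And>n. \<bar>d n\<bar> \<le> c n"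
    and \<kappa>: "0 \<le> \<kappa>" "\<kappa> < 1" and often: "\<And>N. \<exists>n\<ge>N. \<bar>d n\<bar> \<le> \<kappa> * c n"
  shows "\<exists>N. \<forall>n\<ge>N. \<bar>three_term d u v n\<bar> \<le> max \<bar>u\<bar> \<bar>v\<bar> * ((3 + \<kappa>) / 4) ^ k * three_term c 1 1 n"
proof (induction k)
  case 0
  have "\<bar>three_term d u v n\<bar> \<le> max \<bar>u\<bar> \<bar>v\<bar> * three_term c 1 1 n" for n
    by (rule three_term_dominated_from[of c d u v 0]) (use c d in auto)
  then show ?case by auto
next
  case (Suc k)
  let ?s = "three_term d u v" and ?Q = "three_term c 1 1"
  define K where "K = max \<bar>u\<bar> \<bar>v\<bar> * ((3 + \<kappa>) / 4) ^ k"
  have K: "0 \<le> K" unfolding K_def using \<kappa> by (intro mult_nonneg_nonneg) auto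
  from Suc obtain N where N: "\<And>n. N \<le> n \<Longrightarrow> \<bar>?s n\<bar> \<le> K * ?Q n" unfolding K_def by blast
  obtain n where n: "N \<le> n" "\<bar>d n\<bar> \<le> \<kappa> * c n" using often by blast
  note Q = continuant_mono[of c, OF c]
  \<comment> \<open>A weighted mean of \<open>\<mu>\<close> and 1 that gives \<open>\<mu>\<close> at least half of the weight.\<close>
  have mean: "C * (\<mu> * q) + p \<le> (1 + \<mu>) / 2 * (C * q + p)"
    if "1 \<le> C" "0 \<le> p" "p \<le> q" "\<mu> \<le> 1" for C \<mu> p q :: real
  proof -
    have "p \<le> C * q" using that by (smt (verit) mult_le_cancel_right1)
    then have "0 \<le> (1 - \<mu>) * (C * q - p)" using that by simp
    then show ?thesis by (simp add: field_simps)
  qed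
  have a: "\<bar>?s (Suc (Suc n))\<bar> \<le> (1 + \<kappa>) / 2 * (K * ?Q (Suc (Suc n)))"
  proof -
    have "\<bar>d n * ?s (Suc n)\<bar> \<le> \<kappa> * c n * (K * ?Q (Suc n))"
      unfolding abs_mult using n N[of "Suc n"] by (intro mult_mono) (auto intro: order_trans[OF abs_ge_zero])
    then have "\<bar>?s (Suc (Suc n))\<bar> \<le> \<kappa> * c n * (K * ?Q (Suc n)) + K * ?Q n"
      using N[of n] n(1) by simp
    also have "\<dots> = K * (c n * (\<kappa> * ?Q (Suc n)) + ?Q n)" by (simp add: algebra_simps)
    also have "\<dots> \<le> K * ((1 + \<kappa>) / 2 * (c n * ?Q (Suc n) + ?Q n))"
      using Q[of n] c[of n] \<kappa> K by (intro mult_left_mono mean) auto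
    finally show ?thesis by (simp add: algebra_simps)
  qed
  have b: "\<bar>?s (Suc (Suc (Suc n)))\<bar> \<le> (3 + \<kappa>) / 4 * (K * ?Q (Suc (Suc (Suc n))))"
  proof -
    have "\<bar>d (Suc n) * ?s (Suc (Suc n))\<bar> \<le> c (Suc n) * ((1 + \<kappa>) / 2 * (K * ?Q (Suc (Suc n))))"
      unfolding abs_mult using a d[of "Suc n"] by (intro mult_mono) (auto intro: order_trans[OF abs_ge_zero])
    then have "\<bar>?s (Suc (Suc (Suc n)))\<bar> \<le> c (Suc n) * ((1 + \<kappa>) / 2 * (K * ?Q (Suc (Suc n)))) + K * ?Q (Suc n)"
      using N[of "Suc n"] n(1) by simp
    also have "\<dots> = K * (c (Suc n) * ((1 + \<kappa>) / 2 * ?Q (Suc (Suc n))) + ?Q (Suc n))"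
      by (simp add: algebra_simps)
    also have "\<dots> \<le> K * ((1 + (1 + \<kappa>) / 2) / 2 * (c (Suc n) * ?Q (Suc (Suc n)) + ?Q (Suc n)))"
      using Q[of "Suc n"] c[of "Suc n"] \<kappa> K by (intro mult_left_mono mean) auto
    finally show ?thesis by (simp add: field_simps)
  qed
  have "(1 + \<kappa>) / 2 * (K * ?Q (Suc (Suc n))) \<le> (3 + \<kappa>) / 4 * (K * ?Q (Suc (Suc n)))"
    using Q[of "Suc (Suc n)"] K \<kappa> by (intro mult_right_mono) auto
  with a have a': "\<bar>?s (Suc (Suc n))\<bar> \<le> (3 + \<kappa>) / 4 * K * ?Q (Suc (Suc n))"
    by (simp only: mult.assoc)
  have "\<bar>?s m\<bar> \<le> (3 + \<kappa>) / 4 * K * ?Q m" if "Suc (Suc n) \<le> m" for m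
    by (rule three_term_dominated_from[OF c d a' _ that]) (use b in \<open>simp add: mult.assoc\<close>)
  then show ?case unfolding K_def by (intro exI[of _ "Suc (Suc n)"]) (auto simp: mult_ac)
qed

text \<open>
  Both summands are nonnegative when the remainders are, so the remainders are \<open>O(1 / Q n)\<close>, where
  \<open>Q\<close> denotes the continuants.
\<close>

lemma remainder_continuant_invariant:
  "three_term c 1 1 (Suc n) * three_term (\<lambda>n. - c n) u v n
   + three_term c 1 1 n * three_term (\<lambda>n. - c n) u v (Suc n) = u + v"
proof (induction n)
  case (Suc n)
  then show ?case by (simp only: three_term.simps) (simp add: algebra_simps del: three_term.simps)
qed simp

text \<open>
  The norm of a remainder is its product with its conjugate.  The remainder is \<open>O(1 / Q n)\<close> and its
  conjugate is \<open>o(Q n)\<close>, so the norms would tend to 0.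
\<close>

lemma remainder_norms_not_bounded_below:
  assumes c: "\<And>n. 1 \<le> c n" and d: "\<And>n. \<bar>d n\<bar> \<le> c n"
    and \<kappa>: "0 \<le> \<kappa>" "\<kappa> < 1" and often: "\<And>N. \<exists>n\<ge>N. \<bar>d n\<bar> \<le> \<kappa> * c n"
    and pos: "\<And>n. 0 < three_term (\<lambda>n. - c n) u v n"
    and norm: "\<And>n. 1 \<le> \<bar>three_term (\<lambda>n. - c n) u v n * three_term (\<lambda>n. - d n) u' v' n\<bar>"
  shows False
proof -
  let ?r = "three_term (\<lambda>n. - c n) u v" and ?s = "three_term (\<lambda>n. - d n) u' v'"
    and ?Q = "three_term c 1 1"
  define M where "M = max \<bar>u'\<bar> \<bar>v'\<bar>"
  note Q = continuant_mono[of c, OF c]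
  have r: "?r n * ?Q n \<le> u + v" for n
  proof -
    have "?r n * ?Q n \<le> ?r n * ?Q (Suc n)"
      using Q[of n] pos[of n] by (intro mult_left_mono) auto
    moreover have "0 \<le> ?Q n * ?r (Suc n)" using Q[of n] pos[of "Suc n"]
      by (intro mult_nonneg_nonneg) auto
    ultimately show ?thesis using remainder_continuant_invariant[of c n u v] by (simp add: mult.commute)
  qed
  have M: "0 \<le> M" by (simp add: M_def)
  have bound: "1 \<le> (u + v) * M * ((3 + \<kappa>) / 4) ^ k" for k
  proof -
    obtain n where n: "\<bar>?s n\<bar> \<le> M * ((3 + \<kappa>) / 4) ^ k * ?Q n"
      using three_term_decay[of c "\<lambda>n. - d n" \<kappa> u' v' k] c d \<kappa> often unfolding M_def by auto
    have "1 \<le> ?r n * \<bar>?s n\<bar>" using norm[of n] pos[of n] by (simp add: abs_mult)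
    also have "\<dots> \<le> ?r n * (M * ((3 + \<kappa>) / 4) ^ k * ?Q n)"
      using n pos[of n] by (intro mult_left_mono) auto
    also have "\<dots> = (?r n * ?Q n) * (M * ((3 + \<kappa>) / 4) ^ k)" by (simp only: mult_ac)
    also have "\<dots> \<le> (u + v) * (M * ((3 + \<kappa>) / 4) ^ k)"
      using r[of n] M \<kappa> by (intro mult_right_mono) auto
    finally show ?thesis by (simp add: mult.assoc)
  qed
  have "0 < (u + v) * M" using bound[of 0] by simp
  then obtain k where "((3 + \<kappa>) / 4) ^ k < 1 / ((u + v) * M)"
    using real_arch_pow_inv[of "1 / ((u + v) * M)" "(3 + \<kappa>) / 4"] \<kappa> by auto
  with \<open>0 < (u + v) * M\<close> have "(u + v) * M * ((3 + \<kappa>) / 4) ^ k < 1"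
    by (simp add: field_simps)
  with bound[of k] show False by linarith
qed

section \<open>Quadratic fields\<close>

lemma sqrt_irrational_between_squares:
  assumes "k * k < n" "n < (k + 1) * (k + 1)"
  shows "sqrt (real n) \<notin> \<rat>"
proof
  assume "sqrt (real n) \<in> \<rat>"
  moreover have "algebraic_int (sqrt (real n))" by (intro algebraic_int_sqrt) auto
  ultimately have "sqrt (real n) \<in> \<int>" by (rule rational_algebraic_int_is_int[rotated])
  then obtain i where i: "sqrt (real n) = of_int i" by (elim Ints_cases)
  have "0 \<le> i" using i by (metis of_int_0_le_iff real_sqrt_ge_zero of_nat_0_le_iff)
  then obtain m where m: "i = int m" by (metis zero_le_imp_eq_int)
  then have "real n = real (m * m)" using i real_sqrt_mult_self[of "real n"] by simp
  then have "n = m * m" by (simp only: of_nat_eq_iff)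
  then have "k < m" "m < k + 1" using assms
    by (metis mult_le_mono not_le)+
  then show False by simp
qed

text \<open>
  Squaring an equation \<open>sqrt p = s + t * sqrt q\<close> makes \<open>sqrt q\<close>, and then \<open>sqrt p\<close>, rational
  unless \<open>s\<close> or \<open>t\<close> vanishes; for \<open>s = 0\<close> one multiplies by \<open>sqrt q\<close> instead.
\<close>

lemma sqrt_not_in_quadratic_field:
  fixes p q :: nat and s t :: real
  assumes "sqrt (real p) \<notin> \<rat>" "sqrt (real (p * q)) \<notin> \<rat>" "s \<in> \<rat>" "t \<in> \<rat>"
  shows "sqrt (real p) \<noteq> s + t * sqrt (real q)"
proof
  assume eq: "sqrt (real p) = s + t * sqrt (real q)"
  have "real p = (sqrt (real p))\<^sup>2" by simp
  also have "\<dots> = s\<^sup>2 + t\<^sup>2 * real q + 2 * s * t * sqrt (real q)"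
    unfolding eq by (simp add: power2_sum power_mult_distrib)
  finally have sq: "2 * s * t * sqrt (real q) = real p - s\<^sup>2 - t\<^sup>2 * real q" by simp
  consider "t = 0" | "s = 0" | "s \<noteq> 0" "t \<noteq> 0" by blast
  then show False
  proof cases
    case 1
    with eq assms show False by simp
  next
    case 2
    have "sqrt (real (p * q)) = t * real q" using eq 2 by (simp add: real_sqrt_mult)
    then show False using assms by (metis Rats_mult Rats_of_nat)
  next
    case 3
    then have "sqrt (real q) = (real p - s\<^sup>2 - t\<^sup>2 * real q) / (2 * s * t)"
      using sq by (simp add: field_simps)
    also have "\<dots> \<in> \<rat>" using assms by (intro Rats_divide Rats_diff Rats_mult Rats_power) auto
    finally have "s + t * sqrt (real q) \<in> \<rat>" using assms by (intro Rats_add Rats_mult)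
    with assms(1) show False by (simp only: eq not_True_eq_False)
  qed
qed

lemma type_algebra_simps:
  fixes x y :: real
  shows "x \<otimes>\<^bsub>ring_of_type_algebra\<^esub> y = x * y" "x \<oplus>\<^bsub>ring_of_type_algebra\<^esub> y = x + y"
    "\<one>\<^bsub>ring_of_type_algebra\<^esub> = (1 :: real)" "\<zero>\<^bsub>ring_of_type_algebra\<^esub> = (0 :: real)"
    "carrier ring_of_type_algebra = (UNIV :: real set)"
  by (simp_all add: ring_of_type_algebra_def)

lemma type_algebra_inverses:
  fixes x :: real
  shows type_algebra_a_inv: "\<ominus>\<^bsub>ring_of_type_algebra\<^esub> x = - x"
    and type_algebra_m_inv: "x \<noteq> 0 \<Longrightarrow> inv\<^bsub>ring_of_type_algebra\<^esub> x = inverse x"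
proof -
  interpret R: field "ring_of_type_algebra :: real ring" by (rule field_from_type_algebra)
  show "\<ominus>\<^bsub>ring_of_type_algebra\<^esub> x = - x"
    by (rule R.minus_equality) (simp_all add: type_algebra_simps)
  show "inv\<^bsub>ring_of_type_algebra\<^esub> x = inverse x" if "x \<noteq> 0"
    by (rule R.comm_inv_char) (use that in \<open>simp_all add: type_algebra_simps\<close>)
qed

lemmas generate_real_field = generate_field.intros[where R = "ring_of_type_algebra :: real ring",
    unfolded type_algebra_simps type_algebra_a_inv]

lemma rat_adjoin_generator: "\<beta> \<in> rat_adjoin \<beta>"
  unfolding rat_adjoin_def by (rule generate_real_field(2)) simp

lemma rat_adjoin_one: "1 \<in> rat_adjoin \<beta>"
  unfolding rat_adjoin_def by (rule generate_real_field(1))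

lemma rat_adjoin_uminus: "x \<in> rat_adjoin \<beta> \<Longrightarrow> - x \<in> rat_adjoin \<beta>"
  unfolding rat_adjoin_def by (rule generate_real_field(3))

lemma rat_adjoin_inverse: "x \<in> rat_adjoin \<beta> \<Longrightarrow> x \<noteq> 0 \<Longrightarrow> inverse x \<in> rat_adjoin \<beta>"
  unfolding rat_adjoin_def using generate_real_field(4)[of x] type_algebra_m_inv[of x] by simp

lemma rat_adjoin_add: "x \<in> rat_adjoin \<beta> \<Longrightarrow> y \<in> rat_adjoin \<beta> \<Longrightarrow> x + y \<in> rat_adjoin \<beta>"
  unfolding rat_adjoin_def by (rule generate_real_field(5))

lemma rat_adjoin_mult: "x \<in> rat_adjoin \<beta> \<Longrightarrow> y \<in> rat_adjoin \<beta> \<Longrightarrow> x * y \<in> rat_adjoin \<beta>"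
  unfolding rat_adjoin_def by (rule generate_real_field(6))

lemma rat_adjoin_induct [consumes 1, case_names one generator uminus inverse add mult]:
  assumes "x \<in> rat_adjoin \<beta>"
    and "P 1" "P \<beta>" "\<And>x. P x \<Longrightarrow> P (- x)" "\<And>x. P x \<Longrightarrow> x \<noteq> 0 \<Longrightarrow> P (inverse x)"
    and "\<And>x y. P x \<Longrightarrow> P y \<Longrightarrow> P (x + y)" "\<And>x y. P x \<Longrightarrow> P y \<Longrightarrow> P (x * y)"
  shows "P x"
  using assms(1) unfolding rat_adjoin_def
  by (induction rule: generate_field.induct)
    (use assms(2-) in \<open>simp_all only: type_algebra_simps type_algebra_a_inv type_algebra_m_inv singleton_iff not_False_eq_True\<close>)

lemma rat_adjoin_diff: "x \<in> rat_adjoin \<beta> \<Longrightarrow> y \<in> rat_adjoin \<beta> \<Longrightarrow> x - y \<in> rat_adjoin \<beta>"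
  using rat_adjoin_add[of x \<beta> "- y"] rat_adjoin_uminus[of y \<beta>] by simp

lemma rat_adjoin_of_int: "of_int n \<in> rat_adjoin \<beta>"
proof -
  have nat: "real m \<in> rat_adjoin \<beta>" for m
  proof (induction m)
    case 0
    then show ?case using rat_adjoin_diff[OF rat_adjoin_one rat_adjoin_one] by simp
  next
    case (Suc m)
    then show ?case using rat_adjoin_add[OF rat_adjoin_one Suc] by simp
  qed
  show ?thesis
    using nat rat_adjoin_uminus[OF nat] by (cases n) (auto simp del: of_nat_Suc)
qed

text \<open>
  The base is the positive root of \<open>x\<^sup>2 = a * x + b\<close>.  Positivity of \<open>a\<close> makes it exceed its
  conjugate in absolute value, on which everything below rests.
\<close>

locale quadratic_base =
  fixes a b :: int
  assumes a: "1 \<le> a" and b: "1 \<le> b" and irrational: "sqrt (real_of_int (a\<^sup>2 + 4 * b)) \<notin> \<rat>"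
begin

definition \<Delta> :: real where "\<Delta> = real_of_int (a\<^sup>2 + 4 * b)"
definition \<beta> :: real where "\<beta> = (a + sqrt \<Delta>) / 2"
definition \<beta>' :: real where "\<beta>' = (a - sqrt \<Delta>) / 2"
text \<open>
  The ratio of conjugate to value is at most \<open>\<bar>\<beta>'\<bar> / \<beta>\<close> for a power \<open>\<beta> ^ i\<close> with \<open>i \<ge> 1\<close> and equals
  1 for an integer; \<open>\<kappa>\<close> is the midpoint of the two.
\<close>

definition \<kappa> :: real where "\<kappa> = (1 + \<bar>\<beta>'\<bar> / \<beta>) / 2"

lemma \<Delta>_pos: "0 < \<Delta>"
  using a b unfolding \<Delta>_def by (simp add: add_pos_pos)

lemma roots: "\<beta>\<^sup>2 = a * \<beta> + b" "\<beta>'\<^sup>2 = a * \<beta>' + b" and vieta: "\<beta> + \<beta>' = a" "\<beta> * \<beta>' = - b"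
proof -
  have s: "sqrt \<Delta> * sqrt \<Delta> = real_of_int a * real_of_int a + 4 * real_of_int b"
    using \<Delta>_pos by (simp add: \<Delta>_def power2_eq_square)
  have root: "((A + r) / 2)\<^sup>2 = A * ((A + r) / 2) + B" if "r * r = A * A + 4 * B" for A B r :: real
  proof -
    have "((A + r) / 2)\<^sup>2 = (A * A + 2 * A * r + r * r) / 4"
      by (simp add: power2_eq_square algebra_simps add_divide_distrib)
    then show ?thesis unfolding that by (simp add: algebra_simps add_divide_distrib)
  qed
  show "\<beta>\<^sup>2 = a * \<beta> + b" using root[OF s] by (simp only: \<beta>_def)
  show "\<beta>'\<^sup>2 = a * \<beta>' + b" using root[of "- sqrt \<Delta>" a b] s by (simp only: \<beta>'_def) simp
  show sum: "\<beta> + \<beta>' = a" by (simp add: \<beta>_def \<beta>'_def add_divide_distrib diff_divide_distrib)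
  have "\<beta>' = a - \<beta>" using sum by simp
  then have "\<beta> * \<beta>' = \<beta> * (a - \<beta>)" by (simp only:)
  also have "\<dots> = a * \<beta> - \<beta>\<^sup>2" by (simp add: power2_eq_square algebra_simps)
  finally show "\<beta> * \<beta>' = - b" using \<open>\<beta>\<^sup>2 = a * \<beta> + b\<close> by simp
qed

lemma \<beta>_gt_1: "1 < \<beta>"
proof -
  have "1 < sqrt \<Delta>" using a b unfolding \<Delta>_def by (smt (verit) of_int_1_less_iff real_sqrt_gt_1_iff zero_le_power2)
  moreover have "1 \<le> real_of_int a" using a by simp
  ultimately have "2 < a + sqrt \<Delta>" by linarith
  then show ?thesis by (simp add: \<beta>_def)
qed

lemma conjugate_smaller: "\<bar>\<beta>'\<bar> < \<beta>"
proof -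
  have "0 < real_of_int a" "0 < sqrt \<Delta>" using a \<Delta>_pos by simp_all
  then show ?thesis by (simp add: \<beta>_def \<beta>'_def abs_if)
qed

lemma \<kappa>_bounds: "0 \<le> \<kappa>" "\<kappa> < 1"
  using conjugate_smaller \<beta>_gt_1 by (simp_all add: \<kappa>_def)

text \<open>
  Conjugation on \<open>\<int>[\<beta>]\<close> is kept as a relation, so that no well-definedness is involved in computing
  the conjugate of a sum of digits or of a Euclidean remainder.
\<close>

definition conj_pair :: "real \<Rightarrow> real \<Rightarrow> bool" where
  "conj_pair x x' \<longleftrightarrow> (\<exists>(m :: int) (n :: int). x = m + n * \<beta> \<and> x' = m + n * \<beta>')"

lemma conj_pair_of_int: "conj_pair (of_int m) (of_int m)"
  unfolding conj_pair_def by (rule exI[of _ m], rule exI[of _ 0]) simp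

lemma conj_pair_generator: "conj_pair \<beta> \<beta>'"
  unfolding conj_pair_def by (rule exI[of _ 0], rule exI[of _ 1]) simp

lemma conj_pair_add: "conj_pair x x' \<Longrightarrow> conj_pair y y' \<Longrightarrow> conj_pair (x + y) (x' + y')"
  unfolding conj_pair_def
proof (elim exE conjE)
  fix m n k l :: int
  assume "x = m + n * \<beta>" "x' = m + n * \<beta>'" "y = k + l * \<beta>" "y' = k + l * \<beta>'"
  then show "\<exists>(m :: int) (n :: int). x + y = m + n * \<beta> \<and> x' + y' = m + n * \<beta>'"
    by (intro exI[of _ "m + k"] exI[of _ "n + l"]) (simp add: algebra_simps)
qed

lemma conj_pair_mult: "conj_pair x x' \<Longrightarrow> conj_pair y y' \<Longrightarrow> conj_pair (x * y) (x' * y')"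
  unfolding conj_pair_def
proof (elim exE conjE)
  fix m n k l :: int
  assume *: "x = m + n * \<beta>" "x' = m + n * \<beta>'" "y = k + l * \<beta>" "y' = k + l * \<beta>'"
  have "(m + n * z) * (k + l * z) = (m * k + n * l * b) + (m * l + n * k + n * l * a) * z"
    if "z\<^sup>2 = a * z + b" for z :: real
  proof -
    have "(m + n * z) * (k + l * z) = m * k + (m * l + n * k) * z + n * l * z\<^sup>2"
      by (simp add: algebra_simps power2_eq_square)
    then show ?thesis unfolding that by (simp add: algebra_simps)
  qed
  with roots * show "\<exists>(m :: int) (n :: int). x * y = m + n * \<beta> \<and> x' * y' = m + n * \<beta>'"
    by (intro exI[of _ "m * k + n * l * b"] exI[of _ "m * l + n * k + n * l * a"]) simp
qed

lemma conj_pair_uminus: "conj_pair x x' \<Longrightarrow> conj_pair (- x) (- x')"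
  using conj_pair_mult[OF conj_pair_of_int[of "-1"], of x x'] by simp

lemma conj_pair_power: "conj_pair x x' \<Longrightarrow> conj_pair (x ^ n) (x' ^ n)"
proof (induction n)
  case 0
  then show ?case using conj_pair_of_int[of 1] by simp
qed (simp add: conj_pair_mult)

lemma conj_pair_sum:
  "(\<And>i. i < n \<Longrightarrow> conj_pair (f i) (g i)) \<Longrightarrow> conj_pair (\<Sum>i<n. f i) (\<Sum>i<n. g i)" for n :: nat
proof (induction n)
  case 0
  then show ?case using conj_pair_of_int[of 0] by simp
qed (simp add: conj_pair_add)

lemma conj_pair_rat_adjoin: "conj_pair x x' \<Longrightarrow> x \<in> rat_adjoin \<beta>"
  unfolding conj_pair_def
  by (elim exE conjE) (simp add: rat_adjoin_add rat_adjoin_mult rat_adjoin_of_int rat_adjoin_generator)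

lemma \<beta>_irrational:
  fixes m n :: int
  assumes "m + n * \<beta> = 0 \<or> m + n * \<beta>' = 0"
  shows "n = 0"
proof (rule ccontr)
  assume "n \<noteq> 0"
  have "n * sqrt \<Delta> = 2 * (m + n * \<beta>) - (2 * m + n * a)" "n * sqrt \<Delta> = (2 * m + n * a) - 2 * (m + n * \<beta>')"
    unfolding \<beta>_def \<beta>'_def by (simp_all add: algebra_simps)
  then have "real_of_int n * sqrt \<Delta> = of_int (- (2 * m + n * a)) \<or> real_of_int n * sqrt \<Delta> = of_int (2 * m + n * a)"
    using assms by auto
  then obtain k :: int where "real_of_int n * sqrt \<Delta> = of_int k" by blast
  with \<open>n \<noteq> 0\<close> have "sqrt \<Delta> = of_int k / of_int n" by (simp add: field_simps)
  then have "sqrt \<Delta> \<in> \<rat>" by simp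
  with irrational show False by (simp add: \<Delta>_def)
qed

text \<open>
  The norm \<open>m\<^sup>2 + a m n - b n\<^sup>2\<close> is an integer, and it is nonzero because \<open>\<beta>'\<close> is irrational.
\<close>

lemma norm_ge_1:
  assumes "conj_pair x x'" "x \<noteq> 0"
  shows "1 \<le> \<bar>x * x'\<bar>"
proof -
  obtain m n :: int where mn: "x = m + n * \<beta>" "x' = m + n * \<beta>'"
    using assms(1) unfolding conj_pair_def by blast
  have "x' \<noteq> 0" using \<beta>_irrational[of m n] assms(2) mn by auto
  have "x * x' = m * m + m * n * (\<beta> + \<beta>') + n * n * (\<beta> * \<beta>')"
    unfolding mn by (simp add: algebra_simps)
  also have "\<dots> = of_int (m * m + m * n * a - n * n * b)" unfolding vieta by simp
  finally have eq: "x * x' = of_int (m * m + m * n * a - n * n * b)" .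
  moreover have "x * x' \<noteq> 0" using assms(2) \<open>x' \<noteq> 0\<close> by simp
  ultimately have "m * m + m * n * a - n * n * b \<noteq> 0" by (metis of_int_0)
  then have "1 \<le> \<bar>m * m + m * n * a - n * n * b\<bar>" by linarith
  then show ?thesis unfolding eq by (metis of_int_abs of_int_1_le_iff)
qed

lemma rat_adjoin_coordinates:
  assumes "x \<in> rat_adjoin \<beta>"
  shows "\<exists>s t. s \<in> \<rat> \<and> t \<in> \<rat> \<and> x = s + t * sqrt \<Delta>"
  using assms
proof (induction rule: rat_adjoin_induct)
  case one
  then show ?case by (intro exI[of _ 1] exI[of _ 0]) simp
next
  case generator
  then show ?case by (intro exI[of _ "a / 2"] exI[of _ "1 / 2"]) (simp add: \<beta>_def field_simps)
next
  case (uminus x)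
  then obtain s t where "s \<in> \<rat>" "t \<in> \<rat>" "x = s + t * sqrt \<Delta>" by blast
  then show ?case by (intro exI[of _ "- s"] exI[of _ "- t"]) simp
next
  case (inverse x)
  then obtain s t where st: "s \<in> \<rat>" "t \<in> \<rat>" "x = s + t * sqrt \<Delta>" by blast
  define N where "N = s\<^sup>2 - t\<^sup>2 * \<Delta>"
  have N: "N = x * (s - t * sqrt \<Delta>)"
    using \<Delta>_pos by (simp add: N_def st(3) algebra_simps power2_eq_square)
  have "s - t * sqrt \<Delta> \<noteq> 0"
  proof
    assume "s - t * sqrt \<Delta> = 0"
    moreover from this have "t \<noteq> 0" using inverse st by auto
    ultimately have "sqrt \<Delta> = s / t" by (simp add: field_simps)
    then show False using st irrational by (metis Rats_divide \<Delta>_def)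
  qed
  then have "N \<noteq> 0" "inverse x = (s - t * sqrt \<Delta>) / N"
    unfolding N using inverse.hyps by (simp_all add: inverse_eq_divide)
  moreover have "N \<in> \<rat>" using st unfolding N_def \<Delta>_def by (intro Rats_diff Rats_mult Rats_power) auto
  ultimately show ?case using st
    by (intro exI[of _ "s / N"] exI[of _ "- t / N"]) (simp add: field_simps)
next
  case (add x y)
  then obtain s t s' t' where "s \<in> \<rat>" "t \<in> \<rat>" "x = s + t * sqrt \<Delta>"
    "s' \<in> \<rat>" "t' \<in> \<rat>" "y = s' + t' * sqrt \<Delta>" by blast
  then show ?case by (intro exI[of _ "s + s'"] exI[of _ "t + t'"]) (simp add: algebra_simps)
next
  case (mult x y)
  then obtain s t s' t' where st: "s \<in> \<rat>" "t \<in> \<rat>" "x = s + t * sqrt \<Delta>"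
    "s' \<in> \<rat>" "t' \<in> \<rat>" "y = s' + t' * sqrt \<Delta>" by blast
  have "x * y = s * s' + t * t' * (sqrt \<Delta> * sqrt \<Delta>) + (s * t' + t * s') * sqrt \<Delta>"
    unfolding st by (simp add: algebra_simps)
  then have "x * y = (s * s' + t * t' * \<Delta>) + (s * t' + t * s') * sqrt \<Delta>" using \<Delta>_pos by simp
  moreover have "\<Delta> \<in> \<rat>" by (simp add: \<Delta>_def)
  ultimately show ?case using st
    by (intro exI[of _ "s * s' + t * t' * \<Delta>"] exI[of _ "s * t' + t * s'"]) simp
qed

lemma rat_adjoin_fraction:
  assumes "x \<in> rat_adjoin \<beta>"
  obtains u u' v v' where "conj_pair u u'" "conj_pair v v'" "0 < v" "x = u / v"
proof -
  obtain s t where st: "s \<in> \<rat>" "t \<in> \<rat>" "x = s + t * sqrt \<Delta>"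
    using rat_adjoin_coordinates[OF assms] by blast
  obtain p q where pq: "0 < q" "s = real_of_int p / real_of_int q"
    using Rats_cases'[OF st(1)] by metis
  obtain k l where kl: "0 < l" "t = real_of_int k / real_of_int l"
    using Rats_cases'[OF st(2)] by metis
  have "conj_pair (of_int (p * l - q * k * a) + of_int (2 * q * k) * \<beta>)
      (of_int (p * l - q * k * a) + of_int (2 * q * k) * \<beta>')"
    unfolding conj_pair_def by blast
  moreover have "conj_pair (of_int (q * l)) (of_int (q * l))" by (rule conj_pair_of_int)
  moreover have "0 < real_of_int (q * l)" using pq kl by simp
  moreover have "x = (of_int (p * l - q * k * a) + of_int (2 * q * k) * \<beta>) / of_int (q * l)"
    using pq kl st(3) by (simp add: \<beta>_def field_simps)
  ultimately show ?thesis using that by blast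
qed

text \<open>
  A positive power of \<open>\<beta>\<close> shrinks under conjugation at least by the factor \<open>\<bar>\<beta>'\<bar> / \<beta>\<close>, and the units
  digit, which conjugation fixes, is less than half of any positive \<open>\<beta>\<close>-integer with a further
  nonzero digit.
\<close>

lemma beta_integer_conjugate:
  assumes "x \<in> beta_integers \<beta>"
  shows "\<exists>x'. conj_pair x x' \<and>
     (0 \<le> x \<longrightarrow> \<bar>x'\<bar> \<le> x \<and> (\<bar>x'\<bar> \<le> \<kappa> * x \<or> (\<exists>k :: int. x = k \<and> k < \<beta>)))"
proof -
  obtain e :: "nat \<Rightarrow> int" and N where e: "\<And>i. 0 \<le> e i" "\<And>i. e i < \<beta>" "\<And>i. N \<le> i \<Longrightarrow> e i = 0"
    and eq: "\<bar>x\<bar> = (\<Sum>i<N. e i * \<beta> ^ i)" using beta_integer_digits[OF assms] by blast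
  define y where "y = (\<Sum>i<N. e (Suc i) * \<beta> ^ Suc i)"
  define y' where "y' = (\<Sum>i<N. e (Suc i) * \<beta>' ^ Suc i)"
  define \<rho> where "\<rho> = \<bar>\<beta>'\<bar> / \<beta>"
  have \<rho>: "0 \<le> \<rho>" "\<rho> < 1" "\<bar>\<beta>'\<bar> = \<rho> * \<beta>"
    using conjugate_smaller \<beta>_gt_1 by (auto simp: \<rho>_def field_simps)
  have "\<bar>x\<bar> = (\<Sum>i<Suc N. e i * \<beta> ^ i)" using eq e(3)[of N] by simp
  then have x: "\<bar>x\<bar> = e 0 + y" unfolding y_def sum.lessThan_Suc_shift by simp
  have pair: "conj_pair (e 0 + y) (e 0 + y')"
    unfolding y_def y'_def
    by (intro conj_pair_add conj_pair_sum conj_pair_mult conj_pair_power conj_pair_of_int conj_pair_generator)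
  have "\<bar>y'\<bar> \<le> (\<Sum>i<N. \<bar>e (Suc i) * \<beta>' ^ Suc i\<bar>)" unfolding y'_def by (rule sum_abs)
  also have "\<dots> \<le> (\<Sum>i<N. \<rho> * (e (Suc i) * \<beta> ^ Suc i))"
  proof (rule sum_mono)
    fix i
    have "\<bar>\<beta>' ^ Suc i\<bar> = \<rho> ^ Suc i * \<beta> ^ Suc i" unfolding power_abs \<rho>(3) power_mult_distrib ..
    also have "\<dots> \<le> \<rho> * \<beta> ^ Suc i"
      using \<rho> \<beta>_gt_1 by (intro mult_right_mono) (simp_all add: mult_left_le power_le_one)
    finally have "e (Suc i) * \<bar>\<beta>' ^ Suc i\<bar> \<le> e (Suc i) * (\<rho> * \<beta> ^ Suc i)"
      using e(1) by (intro mult_left_mono) auto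
    then show "\<bar>e (Suc i) * \<beta>' ^ Suc i\<bar> \<le> \<rho> * (e (Suc i) * \<beta> ^ Suc i)"
      unfolding abs_mult using e(1)[of "Suc i"] by (simp add: mult_ac)
  qed
  also have "\<dots> = \<rho> * y" unfolding y_def by (simp add: sum_distrib_left)
  finally have y': "\<bar>y'\<bar> \<le> \<rho> * y" .
  have y0: "0 \<le> y" unfolding y_def using e(1) \<beta>_gt_1 by (intro sum_nonneg) auto
  show ?thesis
  proof (cases "0 \<le> x")
    case False
    then have "x = - (e 0 + y)" using x by simp
    then show ?thesis using conj_pair_uminus[OF pair] False by (intro exI[of _ "- (e 0 + y')"]) simp
  next
    case True
    have "\<rho> * y \<le> y" using \<rho> y0 by (simp add: mult_left_le_one_le)
    then have le: "\<bar>e 0 + y'\<bar> \<le> x" using y' x True e(1)[of 0] by linarith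
    have "\<bar>e 0 + y'\<bar> \<le> \<kappa> * x \<or> (\<exists>k :: int. x = k \<and> k < \<beta>)"
    proof (cases "\<exists>i<N. e (Suc i) \<noteq> 0")
      case False
      then have "y = 0" unfolding y_def by simp
      then show ?thesis using x True e(2)[of 0] by auto
    next
      case True
      then obtain i where i: "i < N" "e (Suc i) \<noteq> 0" by blast
      have "\<beta> \<le> \<beta> ^ Suc i" using \<beta>_gt_1 by (simp add: one_le_power)
      also have "1 * \<beta> ^ Suc i \<le> e (Suc i) * \<beta> ^ Suc i"
        using i e(1)[of "Suc i"] \<beta>_gt_1 by (intro mult_right_mono) auto
      also have "\<dots> \<le> y"
        unfolding y_def
        by (rule member_le_sum[where f = "\<lambda>i. e (Suc i) * \<beta> ^ Suc i"]) (use i e \<beta>_gt_1 in auto)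
      finally have "e 0 < y" using e(2)[of 0] by linarith
      then have "0 \<le> (1 - \<rho>) * (y - e 0)" using \<rho> by simp
      then have "e 0 + \<rho> * y \<le> \<kappa> * (e 0 + y)"
        by (simp add: \<kappa>_def \<rho>_def[symmetric] field_simps)
      then show ?thesis using x \<open>0 \<le> x\<close> y' e(1)[of 0] by auto
    qed
    with le pair x True show ?thesis by (intro exI[of _ "e 0 + y'"]) auto
  qed
qed

end

section \<open>Constant continued fractions\<close>

text \<open>
  The map \<open>z \<mapsto> c + 1 / z\<close> contracts distances to its fixed point by the factor \<open>1 / g\<close> on \<open>z \<ge> 1\<close>,
  so a bounded orbit that can be continued backwards indefinitely sits at the fixed point \<open>g\<close>.
\<close>

lemma constant_partial_quotients:
  fixes x :: "nat \<Rightarrow> real" and c :: real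
  assumes c: "1 \<le> c" and x: "\<And>n. 1 \<le> x n" "\<And>n. x n \<le> B" "\<And>n. x n = c + 1 / x (Suc n)"
  shows "x 0 = (c + sqrt (c\<^sup>2 + 4)) / 2"
proof -
  define g where "g = (c + sqrt (c\<^sup>2 + 4)) / 2"
  have "2 < sqrt (c\<^sup>2 + 4)" using c by (intro real_less_rsqrt) simp
  then have g1: "1 < g" using c by (simp add: g_def)
  have s: "sqrt (c\<^sup>2 + 4) * sqrt (c\<^sup>2 + 4) = c\<^sup>2 + 4"
    by (metis abs_of_nonneg add_nonneg_nonneg real_sqrt_abs2 real_sqrt_mult zero_le_numeral zero_le_power2)
  have "g * g = (c * c + 2 * c * sqrt (c\<^sup>2 + 4) + sqrt (c\<^sup>2 + 4) * sqrt (c\<^sup>2 + 4)) / 4"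
    by (simp only: g_def) (simp add: algebra_simps add_divide_distrib)
  then have "g * g = c * g + 1" unfolding s
    by (simp only: g_def) (simp add: algebra_simps add_divide_distrib power2_eq_square)
  then have "g * g / g = (c * g + 1) / g" by (simp only:)
  then have g: "g = c + 1 / g" using g1 by (simp add: add_divide_distrib)
  have step: "\<bar>x n - g\<bar> \<le> \<bar>x (Suc n) - g\<bar> / g" for n
  proof -
    have "x n - g = 1 / x (Suc n) - 1 / g" using x(3)[of n] g by linarith
    also have "\<dots> = (g - x (Suc n)) / g / x (Suc n)"
      using g1 x(1)[of "Suc n"] by (simp add: divide_simps)
    finally have "\<bar>x n - g\<bar> = \<bar>x (Suc n) - g\<bar> / g / x (Suc n)"
      using g1 x(1)[of "Suc n"] by (simp add: abs_minus_commute abs_divide)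
    also have "\<dots> \<le> \<bar>x (Suc n) - g\<bar> / g / 1"
      using g1 x(1)[of "Suc n"] by (intro divide_left_mono) auto
    finally show ?thesis by simp
  qed
  have far: "\<bar>x 0 - g\<bar> \<le> \<bar>x n - g\<bar> / g ^ n" for n
  proof (induction n)
    case (Suc n)
    have "\<bar>x n - g\<bar> / g ^ n \<le> \<bar>x (Suc n) - g\<bar> / g / g ^ n"
      using step[of n] g1 by (intro divide_right_mono) auto
    with Suc show ?case by (simp add: mult.commute)
  qed simp
  have B: "\<bar>x n - g\<bar> \<le> B + g" for n using x(1)[of n] x(2)[of n] g1 by linarith
  have "x 0 = g"
  proof (rule ccontr)
    assume "x 0 \<noteq> g"
    then have pos: "0 < \<bar>x 0 - g\<bar>" by simp
    obtain n where n: "(B + g) / \<bar>x 0 - g\<bar> < g ^ n" using g1 real_arch_pow by blast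
    have "\<bar>x 0 - g\<bar> * g ^ n \<le> \<bar>x n - g\<bar>" using far[of n] g1 by (simp add: field_simps)
    moreover have "B + g < \<bar>x 0 - g\<bar> * g ^ n" using n pos by (simp add: field_simps)
    ultimately show False using B[of n] by linarith
  qed
  then show ?thesis by (simp add: g_def)
qed

section \<open>Infinite beta-continued fractions of field elements\<close>

lemma infinite_beta_cf:
  assumes "\<not> finite_beta_cf \<beta> \<xi>"
  obtains w where "w 0 = \<xi>" "\<And>n. w n \<notin> beta_integers \<beta>"
    "\<And>n. w (Suc n) = 1 / (w n - beta_floor \<beta> (w n))"
proof -
  have ex: "\<exists>x. beta_complete_quotient \<beta> \<xi> n = Some x" for n
    using assms unfolding finite_beta_cf_def beta_partial_quotient_def by auto
  define w where "w n = the (beta_complete_quotient \<beta> \<xi> n)" for n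
  have w: "beta_complete_quotient \<beta> \<xi> n = Some (w n)" for n using ex[of n] by (auto simp: w_def)
  have "w n \<notin> beta_integers \<beta> \<and> w (Suc n) = 1 / (w n - beta_floor \<beta> (w n))" for n
    using w[of "Suc n"] w[of n] by (auto split: if_splits)
  moreover have "w 0 = \<xi>" using w[of 0] by simp
  ultimately show ?thesis using that by blast
qed

context quadratic_base
begin

text \<open>
  The Euclidean remainders of numerator and denominator stay nonzero in \<open>\<int>[\<beta>]\<close>, so their norms are
  at least 1 in absolute value.  A partial quotient that is not a single digit shrinks under
  conjugation by the factor \<open>\<kappa>\<close>; infinitely many of them would push the norms to 0.
\<close>

lemma partial_quotients_eventually_digits:
  assumes \<xi>: "x 0 \<in> rat_adjoin \<beta>" and x: "\<And>n. 1 < x n"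
    and step: "\<And>n. x n = c n + 1 / x (Suc n)" and c: "\<And>n. c n \<in> beta_integers \<beta>" "\<And>n. 1 \<le> c n"
  shows "\<exists>N. \<forall>n\<ge>N. \<exists>k :: int. c n = k \<and> k < \<beta>"
proof (rule ccontr)
  assume neg: "\<not> ?thesis"
  have "\<forall>n. \<exists>d. conj_pair (c n) d \<and> \<bar>d\<bar> \<le> c n \<and> (\<bar>d\<bar> \<le> \<kappa> * c n \<or> (\<exists>k :: int. c n = k \<and> k < \<beta>))"
    using beta_integer_conjugate[OF c(1)] c(2) by (meson order_trans zero_le_one)
  then obtain d where d: "\<And>n. conj_pair (c n) (d n)" "\<And>n. \<bar>d n\<bar> \<le> c n"
    "\<And>n. \<bar>d n\<bar> \<le> \<kappa> * c n \<or> (\<exists>k :: int. c n = k \<and> k < \<beta>)" by metis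
  have often: "\<exists>n\<ge>N. \<bar>d n\<bar> \<le> \<kappa> * c n" for N using neg d(3) by metis
  obtain u u' v v' where uv: "conj_pair u u'" "conj_pair v v'" "0 < v" "x 0 = u / v"
    using rat_adjoin_fraction[OF \<xi>] by blast
  define r where "r = three_term (\<lambda>n. - c n) u v"
  define s where "s = three_term (\<lambda>n. - d n) u' v'"
  have pair: "conj_pair (r n) (s n) \<and> conj_pair (r (Suc n)) (s (Suc n))" for n
  proof (induction n)
    case 0
    then show ?case using uv by (simp add: r_def s_def)
  next
    case (Suc n)
    have "conj_pair (- c n * r (Suc n) + r n) (- d n * s (Suc n) + s n)"
      using Suc d(1) by (intro conj_pair_add conj_pair_mult conj_pair_uminus) auto
    with Suc show ?case by (simp add: r_def s_def)
  qed
  have pos: "0 < r (Suc n) \<and> r n = x n * r (Suc n)" for n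
  proof (induction n)
    case 0
    then show ?case using uv by (simp add: r_def)
  next
    case (Suc n)
    have "r (Suc (Suc n)) = r n - c n * r (Suc n)" by (simp add: r_def)
    also have "\<dots> = (x n - c n) * r (Suc n)" using Suc by (simp add: algebra_simps)
    also have "x n - c n = 1 / x (Suc n)" using step[of n] by simp
    finally have "r (Suc (Suc n)) = r (Suc n) / x (Suc n)" by simp
    then show ?case using Suc x[of "Suc n"] by simp
  qed
  have rpos: "0 < r n" for n using pos[of n] x[of n] by (metis less_trans mult_pos_pos zero_less_one)
  have norm: "1 \<le> \<bar>r n * s n\<bar>" for n using norm_ge_1 pair rpos by (metis less_irrefl)
  show False
    by (rule remainder_norms_not_bounded_below[OF c(2) d(2) \<kappa>_bounds often rpos[unfolded r_def] norm[unfolded r_def s_def]])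
qed

text \<open>
  Complete quotients exceed 1 only from index 2 on: for a negative argument the distance to the floor
  is not controlled, so the complete quotient of index 1 is merely positive.  The bound \<open>y n < \<beta>\<close>
  holds because \<open>\<beta>\<close> is itself a \<open>\<beta>\<close>-integer, larger than the floor of \<open>y n\<close>.
\<close>

lemma infinite_beta_cf_digit_tail:
  assumes \<xi>: "\<xi> \<in> rat_adjoin \<beta>" and inf: "\<not> finite_beta_cf \<beta> \<xi>"
  obtains y :: "nat \<Rightarrow> real" and k :: "nat \<Rightarrow> int" where
    "\<And>n. y n \<in> rat_adjoin \<beta>" "\<And>n. 1 < y n" "\<And>n. y n < \<beta>" "\<And>n. 1 \<le> k n"
    "\<And>n. y n = k n + 1 / y (Suc n)"
proof -
  obtain w where w0: "w 0 = \<xi>" and notin: "\<And>n. w n \<notin> beta_integers \<beta>"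
    and w: "\<And>n. w (Suc n) = 1 / (w n - beta_floor \<beta> (w n))" using infinite_beta_cf[OF inf] by blast
  define c where "c n = beta_floor \<beta> (w n)" for n
  have c: "c n \<in> beta_integers \<beta>" for n unfolding c_def by (rule beta_floor_in[OF \<beta>_gt_1])
  have frac: "0 < w n - c n" for n
    using notin[of n] c[of n] beta_floor_le[OF \<beta>_gt_1, of "w n"] by (metis c_def diff_gt_0_iff_gt order_le_less)
  have w': "w n = c n + 1 / w (Suc n)" for n using frac[of n] by (simp add: w c_def)
  have mem: "w n \<in> rat_adjoin \<beta>" for n
  proof (induction n)
    case (Suc n)
    obtain d where "conj_pair (c n) d" using beta_integer_conjugate[OF c] by blast
    then have "w n - c n \<in> rat_adjoin \<beta>" using Suc rat_adjoin_diff conj_pair_rat_adjoin by blast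
    then have "inverse (w n - c n) \<in> rat_adjoin \<beta>" using frac[of n] by (intro rat_adjoin_inverse) auto
    then show ?case by (simp add: w c_def inverse_eq_divide)
  qed (simp add: w0 \<xi>)
  have wpos: "0 < w (Suc n)" for n using frac[of n] by (simp add: w c_def)
  have w1: "1 < w (Suc (Suc n))" for n
    using frac[of "Suc n"] beta_floor_gap[OF \<beta>_gt_1, of "w (Suc n)"] wpos[of n]
    by (simp add: w[of "Suc n"] c_def)
  have c1: "1 \<le> c (Suc (Suc n))" for n
    unfolding c_def using power_beta_integer[OF \<beta>_gt_1, of 0] w1[of n]
    by (intro beta_floor_greatest[OF \<beta>_gt_1]) auto
  obtain N where N: "\<And>n. N \<le> n \<Longrightarrow> \<exists>k :: int. c (Suc (Suc n)) = k \<and> k < \<beta>"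
    using partial_quotients_eventually_digits[of "\<lambda>n. w (Suc (Suc n))" "\<lambda>n. c (Suc (Suc n))"] mem w1 w' c c1
    by blast
  define y where "y n = w (Suc (Suc (n + N)))" for n
  have "\<forall>n. \<exists>k :: int. c (Suc (Suc (n + N))) = k \<and> k < \<beta>" using N by simp
  then obtain k :: "nat \<Rightarrow> int" where k: "\<And>n. c (Suc (Suc (n + N))) = k n" "\<And>n. k n < \<beta>" by metis
  have "y n < \<beta>" for n
  proof (rule ccontr)
    assume "\<not> y n < \<beta>"
    then have "\<beta> \<le> c (Suc (Suc (n + N)))"
      unfolding c_def y_def using power_beta_integer[OF \<beta>_gt_1, of 1]
      by (intro beta_floor_greatest[OF \<beta>_gt_1]) auto
    then show False using k[of n] by simp
  qed
  moreover have "1 \<le> k n" for n using c1[of "n + N"] k(1)[of n] by simp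
  moreover have "y n = k n + 1 / y (Suc n)" for n
    using w'[of "Suc (Suc (n + N))"] k(1)[of n] by (simp add: y_def)
  moreover have "y n \<in> rat_adjoin \<beta>" "1 < y n" for n by (simp_all add: y_def mem w1)
  ultimately show ?thesis using that by blast
qed

text \<open>
  A constant tail has the value \<open>(k + sqrt (k\<^sup>2 + 4)) / 2\<close>, which would put \<open>sqrt (k\<^sup>2 + 4)\<close> into
  the field.
\<close>

lemma no_constant_digit_tail:
  fixes q :: nat and k :: int
  assumes y: "\<And>n. y n \<in> rat_adjoin \<beta>" "\<And>n. 1 < y n" "\<And>n. y n < \<beta>" "\<And>n. y n = k + 1 / y (Suc n)"
    and k: "1 \<le> k" and \<Delta>: "\<Delta> = real q"
    and irr: "sqrt (real p) \<notin> \<rat>" "sqrt (real (p * q)) \<notin> \<rat>" and p: "real_of_int (k\<^sup>2 + 4) = real p"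
  shows False
proof -
  have "y 0 = (k + sqrt ((real_of_int k)\<^sup>2 + 4)) / 2"
    by (rule constant_partial_quotients[where x = y, OF _ less_imp_le[OF y(2)] less_imp_le[OF y(3)] y(4)]) (use k in simp)
  then have "y 0 = (k + sqrt (real p)) / 2" using p by simp
  moreover obtain s t where st: "s \<in> \<rat>" "t \<in> \<rat>" "y 0 = s + t * sqrt \<Delta>"
    using rat_adjoin_coordinates[OF y(1)] by blast
  ultimately have "sqrt (real p) = (2 * s - k) + (2 * t) * sqrt (real q)" using \<Delta> by simp
  moreover have "2 * s - k \<in> \<rat>" "2 * t \<in> \<rat>" using st by auto
  ultimately show False using sqrt_not_in_quadratic_field[OF irr] by blast
qed

end

section \<open>The four bases\<close>

lemma quadratic_base_of_nonsquare:
  assumes "1 \<le> a" "1 \<le> b" "a\<^sup>2 + 4 * b = int n" "k * k < n" "n < (k + 1) * (k + 1)"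
  shows "quadratic_base a b"
proof
  show "sqrt (real_of_int (a\<^sup>2 + 4 * b)) \<notin> \<rat>"
    using sqrt_irrational_between_squares[OF assms(4,5)] unfolding assms(3) by simp
qed (use assms in auto)

text \<open>
  Here the constant tail \<open>[1, 1, \<dots>]\<close> does have its value in the field, but the value is \<open>\<beta>\<close>, whereas
  complete quotients in the tail stay below \<open>\<beta>\<close>.
\<close>

lemma golden_CFF: "CFF ((1 + sqrt 5) / 2)"
proof -
  interpret quadratic_base 1 1 by (rule quadratic_base_of_nonsquare[of _ _ 5 2]) auto
  have \<beta>: "\<beta> = (1 + sqrt 5) / 2" by (simp add: \<beta>_def \<Delta>_def)
  have "sqrt 5 < 3" by (rule real_less_lsqrt) auto
  then have less2: "\<beta> < 2" by (simp add: \<beta>)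
  have "finite_beta_cf \<beta> \<xi>" if \<xi>: "\<xi> \<in> rat_adjoin \<beta>" for \<xi>
  proof (rule ccontr)
    assume "\<not> finite_beta_cf \<beta> \<xi>"
    then obtain y and k :: "nat \<Rightarrow> int" where "\<And>n. y n \<in> rat_adjoin \<beta>"
      and y: "\<And>n. 1 < y n" "\<And>n. y n < \<beta>" "\<And>n. 1 \<le> k n" "\<And>n. y n = k n + 1 / y (Suc n)"
      using infinite_beta_cf_digit_tail[OF \<xi>] by blast
    have k: "k n = 1" for n
    proof -
      have "0 < 1 / y (Suc n)" using y(1)[of "Suc n"] by simp
      then have "real_of_int (k n) < 2" using y(2)[of n] y(4)[of n] less2 by linarith
      then show ?thesis using y(3)[of n] by simp
    qed
    have step: "y n = 1 + 1 / y (Suc n)" for n using y(4)[of n] k[of n] by simp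
    have "y 0 = (1 + sqrt (1\<^sup>2 + 4)) / 2"
      by (rule constant_partial_quotients[where x = y, OF _ less_imp_le[OF y(1)] less_imp_le[OF y(2)] step]) simp
    then show False using y(2)[of 0] by (simp add: \<beta>)
  qed
  then show ?thesis unfolding CFF_def \<beta> by blast
qed

text \<open>
  A digit 2 forces the next complete quotient to exceed \<open>1 / (\<beta> - 2)\<close>, which is at least \<open>\<beta>\<close> under
  the second hypothesis.  So the tail consists of the digit 1 alone and has the value
  \<open>(1 + sqrt 5) / 2\<close>.
\<close>

lemma (in quadratic_base) CFF_if_two_impossible:
  assumes \<beta>: "\<beta> < 3" "\<beta> * (\<beta> - 2) \<le> 1"
    and \<Delta>: "\<Delta> = real q" and irr: "sqrt (real (5 * q)) \<notin> \<rat>"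
  shows "CFF \<beta>"
  unfolding CFF_def
proof (intro ballI, rule ccontr)
  fix \<xi> assume "\<xi> \<in> rat_adjoin \<beta>" "\<not> finite_beta_cf \<beta> \<xi>"
  then obtain y and k :: "nat \<Rightarrow> int" where y: "\<And>n. y n \<in> rat_adjoin \<beta>" "\<And>n. 1 < y n" "\<And>n. y n < \<beta>"
    "\<And>n. 1 \<le> k n" "\<And>n. y n = k n + 1 / y (Suc n)" using infinite_beta_cf_digit_tail by blast
  have k: "k n = 1" for n
  proof (rule ccontr)
    assume "k n \<noteq> 1"
    then have "2 \<le> real_of_int (k n)" using y(4)[of n] by linarith
    then have "1 / y (Suc n) < \<beta> - 2" using y(3)[of n] y(5)[of n] by linarith
    then have "1 < (\<beta> - 2) * y (Suc n)" using y(2)[of "Suc n"] by (simp add: pos_divide_less_eq)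
    moreover have "0 < 1 / y (Suc n)" using y(2)[of "Suc n"] by simp
    then have "0 < \<beta> - 2" using \<open>1 / y (Suc n) < \<beta> - 2\<close> by linarith
    then have "(\<beta> - 2) * y (Suc n) \<le> (\<beta> - 2) * \<beta>"
      using y(3)[of "Suc n"] by (intro mult_left_mono) auto
    ultimately show False using \<beta>(2) by (simp add: mult.commute)
  qed
  have step: "y n = of_int 1 + 1 / y (Suc n)" for n using y(5)[of n] k[of n] by simp
  show False
    by (rule no_constant_digit_tail[where y = y, OF y(1-3) step _ \<Delta> _ irr])
      (use sqrt_irrational_between_squares[of 2 5] in simp_all)
qed

lemma silver_CFF: "CFF (1 + sqrt 2)"
proof -
  interpret quadratic_base 2 1 by (rule quadratic_base_of_nonsquare[of _ _ 8 2]) auto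
  have "sqrt 8 = sqrt (4 * 2)" by simp
  also have "\<dots> = 2 * sqrt 2" by (simp only: real_sqrt_mult real_sqrt_four)
  finally have \<beta>: "\<beta> = 1 + sqrt 2" by (simp add: \<beta>_def \<Delta>_def)
  have "sqrt 2 < 2" by (rule real_less_lsqrt) auto
  then have "\<beta> < 3" by (simp add: \<beta>)
  moreover have "\<beta> * (\<beta> - 2) \<le> 1" using roots(1) by (simp add: power2_eq_square algebra_simps)
  ultimately have "CFF \<beta>"
    using sqrt_irrational_between_squares[of 6 40]
    by (intro CFF_if_two_impossible[of 8]) (auto simp: \<Delta>_def)
  then show ?thesis by (simp add: \<beta>)
qed

lemma sqrt13_CFF: "CFF ((1 + sqrt 13) / 2)"
proof -
  interpret quadratic_base 1 3 by (rule quadratic_base_of_nonsquare[of _ _ 13 3]) auto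
  have \<beta>: "\<beta> = (1 + sqrt 13) / 2" by (simp add: \<beta>_def \<Delta>_def)
  have "sqrt 13 < 5" "3 < sqrt 13" by (auto intro: real_less_lsqrt real_less_rsqrt)
  then have "\<beta> < 3" "2 < \<beta>" by (simp_all add: \<beta>)
  moreover from this have "\<beta> * (\<beta> - 2) \<le> 1" using roots(1) by (simp add: power2_eq_square algebra_simps)
  ultimately have "CFF \<beta>"
    using sqrt_irrational_between_squares[of 8 65]
    by (intro CFF_if_two_impossible[of 13]) (auto simp: \<Delta>_def)
  then show ?thesis by (simp add: \<beta>)
qed

text \<open>
  The digit 2 can occur for this base, but only followed by another 2.  So the tail is eventually
  constant, and its value generates \<open>\<rat>(sqrt 5)\<close> or \<open>\<rat>(sqrt 8)\<close>.
\<close>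

lemma sqrt17_CFF: "CFF ((1 + sqrt 17) / 2)"
proof -
  interpret quadratic_base 1 4 by (rule quadratic_base_of_nonsquare[of _ _ 17 4]) auto
  have \<beta>: "\<beta> = (1 + sqrt 17) / 2" by (simp add: \<beta>_def \<Delta>_def)
  have \<Delta>: "\<Delta> = real 17" by (simp add: \<Delta>_def)
  have "sqrt 17 < 29 / 7" by (rule real_less_lsqrt) (auto simp: power2_eq_square)
  then have small: "\<beta> < 18 / 7" by (simp add: \<beta>)
  have "finite_beta_cf \<beta> \<xi>" if \<xi>: "\<xi> \<in> rat_adjoin \<beta>" for \<xi>
  proof (rule ccontr)
    assume "\<not> finite_beta_cf \<beta> \<xi>"
    then obtain y and k :: "nat \<Rightarrow> int" where y: "\<And>n. y n \<in> rat_adjoin \<beta>" "\<And>n. 1 < y n" "\<And>n. y n < \<beta>"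
      "\<And>n. 1 \<le> k n" "\<And>n. y n = k n + 1 / y (Suc n)" using infinite_beta_cf_digit_tail[OF \<xi>] by blast
    have inv: "7 / 18 < 1 / y n" for n using y(2,3)[of n] small by (simp add: field_simps)
    have k: "k n = 1 \<or> k n = 2" for n
    proof -
      have "real_of_int (k n) < 3" using y(3)[of n] y(5)[of n] inv[of "Suc n"] small by linarith
      then show ?thesis using y(4)[of n] by linarith
    qed
    \<comment> \<open>A digit 2 followed by a digit 1 makes the next three complete quotients more than \<open>7 / 4\<close>,
      less than \<open>4 / 3\<close> and more than 3, the last being above \<open>\<beta>\<close>.\<close>
    have stay: "k (Suc n) = 2" if "k n = 2" for n
    proof (rule ccontr)
      assume "k (Suc n) \<noteq> 2"
      then have "k (Suc n) = 1" using k by blast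
      have "1 / y (Suc n) < 4 / 7" using y(3)[of n] y(5)[of n] that small by simp
      then have "7 / 4 < y (Suc n)" using y(2)[of "Suc n"] by (simp add: field_simps)
      then have "3 / 4 < 1 / y (Suc (Suc n))" using y(5)[of "Suc n"] \<open>k (Suc n) = 1\<close> by simp
      then have "y (Suc (Suc n)) < 4 / 3" using y(2)[of "Suc (Suc n)"] by (simp add: field_simps)
      moreover have "1 \<le> real_of_int (k (Suc (Suc n)))" using y(4) by simp
      ultimately have "1 / y (Suc (Suc (Suc n))) < 1 / 3" using y(5)[of "Suc (Suc n)"] by linarith
      then have "3 < y (Suc (Suc (Suc n)))" using y(2)[of "Suc (Suc (Suc n))"] by (simp add: field_simps)
      with y(3)[of "Suc (Suc (Suc n))"] small show False by linarith
    qed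
    show False
    proof (cases "\<exists>n. k n = 2")
      case True
      then obtain N where "k N = 2" by blast
      then have "k (n + N) = 2" for n by (induction n) (auto intro: stay)
      then have step: "y (n + N) = of_int 2 + 1 / y (Suc n + N)" for n using y(5)[of "n + N"] by simp
      show False
        by (rule no_constant_digit_tail[where y = "\<lambda>n. y (n + N)" and p = 8, OF y(1-3) step _ \<Delta>])
          (use sqrt_irrational_between_squares[of 2 8] sqrt_irrational_between_squares[of 11 136] in simp_all)
    next
      case False
      then have k1: "k n = 1" for n using k by blast
      have step: "y n = of_int 1 + 1 / y (Suc n)" for n using y(5)[of n] k1[of n] by simp
      show False
        by (rule no_constant_digit_tail[where y = y and p = 5, OF y(1-3) step _ \<Delta>])
          (use sqrt_irrational_between_squares[of 2 5] sqrt_irrational_between_squares[of 9 85] in simp_all)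
    qed
  qed
  then show ?thesis unfolding CFF_def \<beta> by blast
qed

theorem theorem6p5:
  shows "\<forall>\<beta> \<in> {(1 + sqrt 5) / 2, 1 + sqrt 2, (1 + sqrt 13) / 2, (1 + sqrt 17) / 2 :: real}. CFF \<beta>"
  using golden_CFF silver_CFF sqrt13_CFF sqrt17_CFF by blast

end
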